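(* Let $\mathbb D=\{z\in\mathbb C:|z|<1\}$, and let $\nu:\partial\mathbb D\to\mathbb C$ with $|\nu(\zeta)|=1$ for all $\zeta\in\partial\mathbb D$, and $\varphi:\partial\mathbb D\to\mathbb R$ be measurable functions. Then there exist harmonic functions $u:\mathbb D\to\mathbb R$ such that, for a.e. $\zeta\in\partial\mathbb D$, $$\lim_{z\to\zeta}\frac{\partial u}{\partial\nu}(z)=\varphi(\zeta)$$ along every nontangential path in $\mathbb D$ to $\zeta$.
   Context: A harmonic function is a twice continuously differentiable solution of the Laplace equation $u_{xx}+u_{yy}=0$. Measurability and "a.e." on $\partial\mathbb D$ are with respect to arc length. No integrability or boundedness of $\varphi$ is assumed. For a fixed boundary point $\zeta$ and $z\in\mathbb D$, $\frac{\partial u}{\partial\nu}(z)$ denotes the derivative of $u$ at $z$ in the fixed direction $\nu=\nu(\zeta)$, i.e. $\frac{\partial u}{\partial\nu}(z)=\lim_{t\to0}\frac{u(z+t\nu(\zeta))-u(z)}{t}=\mathrm{Re}\big(\overline{\nu(\zeta)}\,\nabla u(z)\big)$, where $\nabla u=u_x+iu_y$; this is the scalar product of $\nu(\zeta)$ and the gradient viewed as vectors in $\mathbb R^2$. A path in $\mathbb D$ ending at $\zeta\in\partial\mathbb D$ is nontangential if, near $\zeta$, it lies in a set $\{z\in\mathbb D:|z-\zeta|\le M\,\mathrm{dist}(z,\partial\mathbb D)\}$ for some finite $M$ (a Stolz angle at $\zeta$). *)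

theory Defs
  imports "HOL-Analysis.Analysis"
begin

text \<open>Derivative of \<open>u\<close> at \<open>z\<close> in the direction \<open>v\<close>, the limit of
  \<open>(u (z + t v) - u z) / t\<close> as the real parameter \<open>t\<close> tends to 0.
  The directions \<open>1\<close> and \<open>\<i>\<close> give the partial derivatives in \<open>x\<close> and \<open>y\<close>.\<close>

definition dir_differentiable :: "(complex \<Rightarrow> real) \<Rightarrow> complex \<Rightarrow> complex \<Rightarrow> bool" where
  "dir_differentiable u v z \<longleftrightarrow> (\<lambda>t::real. u (z + of_real t * v)) differentiable (at 0)"

definition dir_deriv :: "(complex \<Rightarrow> real) \<Rightarrow> complex \<Rightarrow> complex \<Rightarrow> real" where
  "dir_deriv u v z = deriv (\<lambda>t::real. u (z + of_real t * v)) 0"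

definition C1_on :: "complex set \<Rightarrow> (complex \<Rightarrow> real) \<Rightarrow> bool" where
  "C1_on S u \<longleftrightarrow> open S \<and>
     (\<forall>v\<in>{1, \<i>}. (\<forall>z\<in>S. dir_differentiable u v z) \<and> continuous_on S (dir_deriv u v))"

definition C2_on :: "complex set \<Rightarrow> (complex \<Rightarrow> real) \<Rightarrow> bool" where
  "C2_on S u \<longleftrightarrow> C1_on S u \<and> C1_on S (dir_deriv u 1) \<and> C1_on S (dir_deriv u \<i>)"

definition harmonic_on :: "complex set \<Rightarrow> (complex \<Rightarrow> real) \<Rightarrow> bool" where
  "harmonic_on S u \<longleftrightarrow> C2_on S u \<and>
     (\<forall>z\<in>S. dir_deriv (dir_deriv u 1) 1 z + dir_deriv (dir_deriv u \<i>) \<i> z = 0)"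

text \<open>Arc length on the unit circle (total mass \<open>2 * pi\<close>). The completion is taken so that
  measurability means Lebesgue measurability, not only Borel measurability.\<close>

definition arc_length :: "complex measure" where
  "arc_length = completion
     (distr (restrict_space lborel {0..<2 * pi}) (restrict_space borel (sphere 0 1)) cis)"

definition stolz_angle :: "complex \<Rightarrow> real \<Rightarrow> complex set" where
  "stolz_angle \<zeta> M = {z \<in> ball 0 1. norm (z - \<zeta>) \<le> M * infdist z (sphere 0 1)}"

text \<open>A path in the open disk ending at the boundary point \<open>\<zeta>\<close>; only its endpoint,
  at parameter 1, lies outside the disk.\<close>

definition nontangential_path :: "complex \<Rightarrow> (real \<Rightarrow> complex) \<Rightarrow> bool" where
  "nontangential_path \<zeta> \<gamma> \<longleftrightarrow>
     path \<gamma> \<and> \<gamma> ` {0..<1} \<subseteq> ball 0 1 \<and> pathfinish \<gamma> = \<zeta> \<and>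
     (\<exists>M. eventually (\<lambda>t. \<gamma> t \<in> stolz_angle \<zeta> M) (at_left 1))"

end

theory Submission
  imports Defs "HOL-Complex_Analysis.Complex_Analysis"
begin

text \<open>
  Write \<open>u = Re \<Phi>\<close> with \<open>\<Phi>\<close> holomorphic and \<open>F = \<Phi>'\<close>. The derivative of \<open>u\<close> at \<open>z\<close> in a fixed
  direction \<open>v\<close> is \<open>Re (v * F z)\<close>, so the problem is to find \<open>F\<close> holomorphic in the disk with
  \<open>Re (\<nu> \<zeta> * F z) \<longlongrightarrow> \<phi> \<zeta>\<close> nontangentially for almost every \<open>\<zeta>\<close>: a Riemann-Hilbert problem with
  merely measurable data. The solution below avoids conjugate functions and builds \<open>F\<close> as a series
  of explicit corrections.

  The building block is \<open>G w = - 2 * w / (1 - w)\<close>. It vanishes at \<open>0\<close>, yet \<open>Re G = 1\<close> on the whole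
  unit circle except at \<open>w = 1\<close>. Given a residual \<open>\<psi>\<close>, a Laurent polynomial
  \<open>q \<zeta> = P \<zeta> / \<zeta> ^ K\<close> approximates \<open>\<psi> * cnj \<nu>\<close> outside a set of small measure, and the correction is
  \<open>f z = q z * G (z ^ N)\<close> with \<open>N > K\<close>. It is holomorphic in the disk, because \<open>G (z ^ N)\<close> vanishes
  to order \<open>N\<close> at \<open>0\<close>.
  On the circle \<open>\<nu> * q\<close> is close to the real number \<open>\<psi>\<close>, so \<open>Re (\<nu> * f)\<close> is close to
  \<open>\<psi> * Re G = \<psi>\<close>.

  The point of composing with \<open>z ^ N\<close> is control inside the disk. A Stolz angle at \<open>\<zeta>\<close> is mapped
  by \<open>z ^ N\<close> into the Stolz angle of the same aperture at \<open>\<zeta> ^ N\<close>, so \<open>G (z ^ N)\<close> is bounded there by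
  a constant depending only on the aperture and on the distance of \<open>\<zeta> ^ N\<close> from \<open>1\<close>. For large \<open>N\<close>,
  \<open>f\<close> is negligible away from the circle, while close to the circle \<open>P z\<close> may be replaced by \<open>P \<zeta>\<close>.
  Hence on the Stolz angle \<open>f\<close> is bounded by a constant times \<open>\<bar>\<psi> \<zeta>\<bar>\<close> plus a small error, and
  the constant does not depend on \<open>\<psi>\<close> (lemma \<open>ex_correction\<close>).

  In \<open>ex_holomorphic_with_Re_limit\<close> the residual is corrected repeatedly, each time to an accuracy
  that makes the next correction at most \<open>(1 / 2) ^ n\<close> on Stolz angles of aperture \<open>n\<close>, outside
  exceptional sets of summable measure. By Borel-Cantelli almost every \<open>\<zeta>\<close> is exceptional only finitely often;
  there the series converges uniformly on every Stolz angle, and the residuals tend to \<open>0\<close>.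
\<close>

section \<open>Directional derivatives of real parts of holomorphic functions\<close>

lemma dir_deriv_Re:
  assumes "open S" and "z \<in> S"
    and "(\<Phi> has_field_derivative F) (at z)"
    and u: "\<And>w. w \<in> S \<Longrightarrow> u w = Re (c * \<Phi> w)"
  shows "dir_differentiable u v z" and "dir_deriv u v z = Re (c * v * F)"
proof -
  have line: "((\<lambda>t::real. z + of_real t * v) has_vector_derivative v) (at 0)"
    by (auto intro!: derivative_eq_intros)
  have "((\<Phi> \<circ> (\<lambda>t::real. z + of_real t * v)) has_vector_derivative v * F) (at 0)"
    by (rule field_vector_diff_chain_at[OF line]) (use assms(3) in simp)
  then have "((\<lambda>t::real. c * \<Phi> (z + of_real t * v)) has_vector_derivative c * (v * F)) (at 0)"
    unfolding o_def by (rule has_vector_derivative_mult_right)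
  then have "((\<lambda>t::real. Re (c * \<Phi> (z + of_real t * v))) has_field_derivative Re (c * (v * F))) (at 0)"
    by (rule has_field_derivative_Re)
  moreover have "\<forall>\<^sub>F t in nhds (0::real). Re (c * \<Phi> (z + of_real t * v)) = u (z + of_real t * v)"
  proof -
    have "open ((\<lambda>t::real. z + of_real t * v) -` S)"
      by (rule open_vimage[OF \<open>open S\<close>]) (auto intro!: continuous_intros)
    then have "\<forall>\<^sub>F t in nhds (0::real). z + of_real t * v \<in> S"
      using \<open>z \<in> S\<close> by (auto simp: eventually_nhds)
    then show ?thesis by eventually_elim (simp add: u)
  qed
  ultimately have *: "((\<lambda>t::real. u (z + of_real t * v)) has_field_derivative Re (c * (v * F))) (at 0)"
    by (subst (asm) DERIV_cong_ev[OF refl _ refl]) auto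
  show "dir_differentiable u v z"
    unfolding dir_differentiable_def using * by (metis real_differentiable_def)
  show "dir_deriv u v z = Re (c * v * F)"
    unfolding dir_deriv_def using DERIV_imp_deriv[OF *] by (simp add: mult.assoc)
qed

text \<open>Only the values of \<open>u\<close> on \<open>S\<close> enter. This matters because the lemma is also applied with \<open>u\<close> a
directional derivative, which is known in closed form only on \<open>S\<close>.\<close>

lemma C1_on_Re:
  assumes "open S" and "\<And>z. z \<in> S \<Longrightarrow> (\<Phi> has_field_derivative F z) (at z)"
    and "continuous_on S F" and "\<And>z. z \<in> S \<Longrightarrow> u z = Re (c * \<Phi> z)"
  shows "C1_on S u"
proof -
  have "continuous_on S (dir_deriv u v)" for v
  proof -
    have "continuous_on S (\<lambda>z. Re (c * v * F z))"
      by (intro continuous_intros assms)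
    then show ?thesis
      by (rule continuous_on_eq) (use dir_deriv_Re(2)[OF assms(1) _ assms(2,4)] in simp)
  qed
  then show ?thesis
    unfolding C1_on_def using dir_deriv_Re(1)[OF assms(1) _ assms(2,4)] \<open>open S\<close> by simp
qed

text \<open>The second derivatives in the directions \<open>1\<close> and \<open>\<i>\<close> are \<open>Re F'\<close> and \<open>Re (\<i>\<^sup>2 * F')\<close>.\<close>

lemma harmonic_on_Re_primitive:
  assumes "open S" and F: "F holomorphic_on S"
    and \<Phi>: "\<And>z. z \<in> S \<Longrightarrow> (\<Phi> has_field_derivative F z) (at z)"
  shows "harmonic_on S (\<lambda>z. Re (\<Phi> z))"
    and "z \<in> S \<Longrightarrow> dir_deriv (\<lambda>z. Re (\<Phi> z)) v z = Re (v * F z)"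
proof -
  let ?u = "\<lambda>z. Re (\<Phi> z)"
  have d: "dir_deriv ?u v z = Re (v * F z)" if "z \<in> S" for v z
    using dir_deriv_Re(2)[OF \<open>open S\<close> that \<Phi>[OF that], of ?u 1] by simp
  then show "z \<in> S \<Longrightarrow> dir_deriv ?u v z = Re (v * F z)" .
  have F': "(F has_field_derivative deriv F z) (at z)" if "z \<in> S" for z
    using holomorphic_derivI[OF F \<open>open S\<close> that] .
  have cF: "continuous_on S F" and cF': "continuous_on S (deriv F)"
    using F holomorphic_deriv[OF F \<open>open S\<close>] holomorphic_on_imp_continuous_on by blast+
  have "C1_on S ?u"
    by (rule C1_on_Re[OF \<open>open S\<close> \<Phi> cF, where c = 1]) auto
  moreover have "C1_on S (dir_deriv ?u v)" for v
    by (rule C1_on_Re[OF \<open>open S\<close> F' cF' d])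
  moreover have "dir_deriv (dir_deriv ?u v) v z = Re (v * v * deriv F z)" if "z \<in> S" for v z
    by (rule dir_deriv_Re(2)[OF \<open>open S\<close> that F'[OF that] d])
  ultimately show "harmonic_on S ?u"
    by (simp add: harmonic_on_def C2_on_def)
qed

section \<open>Stolz angles\<close>

lemma infdist_unit_sphere:
  fixes z :: complex
  assumes "norm z < 1"
  shows "infdist z (sphere 0 1) = 1 - norm z"
proof (rule antisym)
  define \<omega> where "\<omega> = (if z = 0 then 1 else sgn z)"
  have "norm \<omega> = 1" and z: "z = norm z *\<^sub>R \<omega>"
    by (auto simp: \<omega>_def norm_sgn sgn_div_norm)
  have "infdist z (sphere 0 1) \<le> dist z \<omega>"
    using \<open>norm \<omega> = 1\<close> by (intro infdist_le) auto
  also have "dist z \<omega> = norm ((norm z - 1) *\<^sub>R \<omega>)"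
    by (subst z) (simp add: dist_norm scaleR_left_diff_distrib)
  also have "\<dots> = 1 - norm z"
    using assms \<open>norm \<omega> = 1\<close> by simp
  finally show "infdist z (sphere 0 1) \<le> 1 - norm z" .
  show "1 - norm z \<le> infdist z (sphere 0 1)"
  proof -
    have "1 - norm z \<le> dist z y" if "y \<in> sphere 0 1" for y :: complex
      using that norm_triangle_ineq2[of y z] by (simp add: dist_norm norm_minus_commute)
    then show ?thesis
      by (auto simp: infdist_notempty intro!: cINF_greatest)
  qed
qed

lemma stolz_angle_iff:
  "z \<in> stolz_angle \<zeta> M \<longleftrightarrow> norm z < 1 \<and> norm (z - \<zeta>) \<le> M * (1 - norm z)"
  by (auto simp: stolz_angle_def infdist_unit_sphere)

lemma stolz_angle_mono: "M \<le> M' \<Longrightarrow> stolz_angle \<zeta> M \<subseteq> stolz_angle \<zeta> M'"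
  by (auto simp: stolz_angle_iff elim!: order_trans intro!: mult_right_mono)

lemma cball_subset_stolz_angle:
  assumes "norm \<zeta> = 1" and "r < 1" and "2 \<le> M * (1 - r)"
  shows "cball 0 r \<subseteq> stolz_angle \<zeta> M"
proof
  fix z :: complex assume "z \<in> cball 0 r"
  then have z: "norm z \<le> r" by simp
  have "M > 0"
    using assms by (metis diff_gt_0_iff_gt less_le_trans zero_less_mult_pos2 zero_less_numeral)
  have "norm (z - \<zeta>) \<le> norm z + norm \<zeta>" by (rule norm_triangle_ineq4)
  also have "\<dots> \<le> 2" using z assms by simp
  also have "\<dots> \<le> M * (1 - norm z)"
    using assms(3) \<open>M > 0\<close> z by (smt (verit) mult_left_mono)
  finally show "z \<in> stolz_angle \<zeta> M" using z assms by (simp add: stolz_angle_iff)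
qed

text \<open>Both \<open>z ^ N - \<zeta> ^ N\<close> and \<open>1 - norm z ^ N\<close> acquire a geometric sum as a factor, and
the sum for the former is dominated by the sum for the latter. So the aperture does not depend
on \<open>N\<close>, which is what makes the frequency \<open>N\<close> free to choose later.\<close>

lemma power_in_stolz_angle:
  assumes z: "z \<in> stolz_angle \<zeta> M" and \<zeta>: "norm \<zeta> = 1" and "N > 0"
  shows "z ^ N \<in> stolz_angle (\<zeta> ^ N) M"
proof -
  have lt: "norm z < 1" and le: "norm (z - \<zeta>) \<le> M * (1 - norm z)"
    using z by (auto simp: stolz_angle_iff)
  have "norm (z ^ N - \<zeta> ^ N) = norm (z - \<zeta>) * norm (\<Sum>i<N. z ^ i * \<zeta> ^ (N - Suc i))"
    using power_diff_sumr2[of z N \<zeta>] by (simp add: norm_mult mult.commute)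
  also have "norm (\<Sum>i<N. z ^ i * \<zeta> ^ (N - Suc i)) \<le> (\<Sum>i<N. norm z ^ i)"
    by (rule order_trans[OF norm_sum]) (simp add: norm_mult norm_power \<zeta>)
  also have "norm (z - \<zeta>) * (\<Sum>i<N. norm z ^ i) \<le> M * (1 - norm z) * (\<Sum>i<N. norm z ^ i)"
    by (intro mult_right_mono le sum_nonneg) auto
  also have "\<dots> = M * (1 - norm z ^ N)"
    using one_diff_power_eq[of "norm z" N] by simp
  finally have "norm (z ^ N - \<zeta> ^ N) \<le> M * (1 - norm (z ^ N))"
    by (simp add: norm_power mult_left_mono)
  moreover have "norm (z ^ N) < 1"
    using lt \<open>N > 0\<close> by (simp add: norm_power power_less_one_iff)
  ultimately show ?thesis by (simp add: stolz_angle_iff)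
qed

text \<open>Moving from \<open>\<zeta>\<close> into its Stolz angle does not bring the pole \<open>1\<close> of \<open>w / (1 - w)\<close> much closer:
\<open>norm (z - \<zeta>)\<close> is controlled by \<open>1 - norm z\<close>, hence by \<open>norm (1 - z)\<close>.\<close>

lemma norm_one_minus_stolz_angle:
  assumes "z \<in> stolz_angle \<zeta> M" and "M \<ge> 0"
  shows "norm (1 - \<zeta>) \<le> (1 + M) * norm (1 - z)"
proof -
  have "1 - norm z \<le> norm (1 - z)"
    using norm_triangle_ineq2[of 1 z] by simp
  then have "M * (1 - norm z) \<le> M * norm (1 - z)"
    using \<open>M \<ge> 0\<close> by (rule mult_left_mono)
  moreover have "norm (1 - \<zeta>) \<le> norm (1 - z) + norm (z - \<zeta>)"
    using norm_triangle_ineq[of "1 - z" "z - \<zeta>"] by simp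
  ultimately show ?thesis
    using assms(1) by (simp add: stolz_angle_iff algebra_simps)
qed

section \<open>Arc length as a Borel measure\<close>

text \<open>Arc length before completion. Measurable functions for the completion agree almost everywhere with
Borel functions, so the construction can be carried out with Borel data.\<close>

definition circle_borel :: "complex measure" where
  "circle_borel = distr (restrict_space lborel {0..<2 * pi}) (restrict_space borel (sphere 0 1)) cis"

lemma arc_length_eq_completion: "arc_length = completion circle_borel"
  by (simp add: arc_length_def circle_borel_def)

lemma sets_circle_borel [measurable_cong]: "sets circle_borel = sets (restrict_space borel (sphere 0 1))"
  and space_circle_borel [simp]: "space circle_borel = sphere 0 1"
  by (auto simp: circle_borel_def space_restrict_space)

lemma cis_measurable: "cis \<in> restrict_space lborel {0..<2 * pi} \<rightarrow>\<^sub>M restrict_space borel (sphere 0 1)"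
proof (rule measurable_restrict_space2)
  have "cis \<in> borel_measurable borel"
    by (rule borel_measurable_continuous_onI) (rule continuous_intros)+
  then have "cis \<in> borel_measurable lborel" by simp
  then show "cis \<in> borel_measurable (restrict_space lborel {0..<2 * pi})"
    by (rule measurable_restrict_space1)
qed auto

lemma cis_measurable_circle_borel [measurable]:
  "cis \<in> restrict_space lborel {0..<2 * pi} \<rightarrow>\<^sub>M circle_borel"
  using cis_measurable by (simp cong: measurable_cong_sets add: sets_circle_borel)

lemma finite_measure_circle_parameter: "finite_measure (restrict_space lborel {0..<2 * pi})"
  by (rule finite_measureI) (simp add: space_restrict_space emeasure_restrict_space)

lemma emeasure_circle_borel:
  assumes "A \<in> sets circle_borel"
  shows "emeasure circle_borel A = emeasure lborel {t \<in> {0..<2 * pi}. cis t \<in> A}"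
proof -
  have "emeasure circle_borel A =
      emeasure (restrict_space lborel {0..<2 * pi}) (cis -` A \<inter> space (restrict_space lborel {0..<2 * pi}))"
    unfolding circle_borel_def
    by (rule emeasure_distr[OF cis_measurable]) (use assms in \<open>simp add: sets_circle_borel\<close>)
  also have "cis -` A \<inter> space (restrict_space lborel {0..<2 * pi}) = {t \<in> {0..<2 * pi}. cis t \<in> A}"
    by (auto simp: space_restrict_space)
  also have "emeasure (restrict_space lborel {0..<2 * pi}) \<dots> = emeasure lborel \<dots>"
    by (rule emeasure_restrict_space) auto
  finally show ?thesis .
qed

lemma finite_measure_circle_borel: "finite_measure circle_borel"
  unfolding circle_borel_def
  by (rule finite_measure.finite_measure_distr[OF finite_measure_circle_parameter cis_measurable])

interpretation circle: finite_measure circle_borel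
  by (rule finite_measure_circle_borel)

lemma measure_circle_borel:
  assumes "A \<in> sets circle_borel"
  shows "measure circle_borel A = measure lborel {t \<in> {0..<2 * pi}. cis t \<in> A}"
  by (simp add: measure_def emeasure_circle_borel[OF assms])

lemma parameter_set_measurable:
  assumes "A \<in> sets circle_borel"
  shows "{t \<in> {0..<2 * pi}. cis t \<in> A} \<in> sets lborel"
proof -
  have "cis -` A \<inter> space (restrict_space lborel {0..<2 * pi}) \<in> sets (restrict_space lborel {0..<2 * pi})"
    by (rule measurable_sets[OF cis_measurable_circle_borel assms])
  moreover have "cis -` A \<inter> space (restrict_space lborel {0..<2 * pi}) = {t \<in> {0..<2 * pi}. cis t \<in> A}"
    by (auto simp: space_restrict_space)
  ultimately show ?thesis by (simp add: sets_restrict_space_iff)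
qed

lemma measure_space_circle_borel: "measure circle_borel (sphere 0 1) = 2 * pi"
proof -
  have "sphere 0 1 \<in> sets circle_borel"
    using sets.top[of circle_borel] by simp
  moreover have "{t \<in> {0..<2 * pi}. cis t \<in> sphere 0 1} = {0..<2 * pi}" by auto
  ultimately show ?thesis by (simp add: measure_circle_borel)
qed

lemma borel_measurable_circle_borel [measurable (raw)]:
  "f \<in> borel_measurable borel \<Longrightarrow> f \<in> borel_measurable circle_borel"
  by (simp cong: measurable_cong_sets add: sets_circle_borel measurable_restrict_space1)

section \<open>Approximation by trigonometric polynomials\<close>

text \<open>On the circle \<open>2 * Re \<zeta> = \<zeta> + 1 / \<zeta>\<close> and \<open>2 * \<i> * Im \<zeta> = \<zeta> - 1 / \<zeta>\<close>, so real polynomials in two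
variables restrict to Laurent polynomials. Multiplying by a power of \<open>\<zeta>\<close> keeps the statement
within polynomials.\<close>

lemma real_polynomial_function_on_circle:
  fixes p :: "complex \<Rightarrow> real"
  assumes "real_polynomial_function p"
  shows "\<exists>P K. \<forall>\<zeta>\<in>sphere 0 1. complex_of_real (p \<zeta>) * \<zeta> ^ K = poly P \<zeta>"
  using assms
proof induction
  case (linear p)
  interpret bounded_linear p by fact
  have "complex_of_real (p \<zeta>) * \<zeta> ^ 1 =
      poly [:(p 1 + \<i> * p \<i>) / 2, 0, (p 1 - \<i> * p \<i>) / 2:] \<zeta>" if "\<zeta> \<in> sphere 0 1" for \<zeta>
  proof -
    have "\<zeta> = Re \<zeta> *\<^sub>R 1 + Im \<zeta> *\<^sub>R \<i>"
      by (simp add: complex_eq_iff)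
    then have "p \<zeta> = Re \<zeta> * p 1 + Im \<zeta> * p \<i>"
      by (metis add scaleR real_scaleR_def)
    moreover have "(Re \<zeta>)\<^sup>2 + (Im \<zeta>)\<^sup>2 = 1"
      using that by (simp add: cmod_def)
    ultimately show ?thesis
      by (simp add: complex_eq_iff power2_eq_square) algebra
  qed
  then show ?case by blast
next
  case (const c)
  have "complex_of_real c * \<zeta> ^ 0 = poly [:of_real c:] \<zeta>" for \<zeta> by simp
  then show ?case by blast
next
  case (add p q)
  then obtain P K Q L where
    "\<forall>\<zeta>\<in>sphere 0 1. complex_of_real (p \<zeta>) * \<zeta> ^ K = poly P \<zeta>"
    "\<forall>\<zeta>\<in>sphere 0 1. complex_of_real (q \<zeta>) * \<zeta> ^ L = poly Q \<zeta>" by blast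
  then have "\<forall>\<zeta>\<in>sphere 0 1. complex_of_real (p \<zeta> + q \<zeta>) * \<zeta> ^ (K + L) =
      poly (P * monom 1 L + Q * monom 1 K) \<zeta>"
    by (simp add: poly_monom power_add algebra_simps)
  then show ?case by blast
next
  case (mult p q)
  then obtain P K Q L where
    "\<forall>\<zeta>\<in>sphere 0 1. complex_of_real (p \<zeta>) * \<zeta> ^ K = poly P \<zeta>"
    "\<forall>\<zeta>\<in>sphere 0 1. complex_of_real (q \<zeta>) * \<zeta> ^ L = poly Q \<zeta>" by blast
  then have "\<forall>\<zeta>\<in>sphere 0 1. complex_of_real (p \<zeta> * q \<zeta>) * \<zeta> ^ (K + L) = poly (P * Q) \<zeta>"
    by (simp add: power_add mult_ac)
  then show ?case by blast
qed

lemma trig_polynomial_approximation: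
  fixes g :: "complex \<Rightarrow> complex"
  assumes "compact S" and S: "S \<subseteq> sphere 0 1" and "continuous_on S g" and "e > 0"
  shows "\<exists>P K. \<forall>\<zeta>\<in>S. norm (poly P \<zeta> - g \<zeta> * \<zeta> ^ K) < e"
proof -
  obtain h where h: "polynomial_function h" and close: "\<And>\<zeta>. \<zeta> \<in> S \<Longrightarrow> norm (g \<zeta> - h \<zeta>) < e"
    using Stone_Weierstrass_polynomial_function[OF assms(1,3,4)] by blast
  have "real_polynomial_function (Re \<circ> h)" "real_polynomial_function (Im \<circ> h)"
    using h bounded_linear_Re bounded_linear_Im unfolding polynomial_function_def by blast+
  from this[THEN real_polynomial_function_on_circle] obtain P K Q L where
    P: "\<forall>\<zeta>\<in>sphere 0 1. complex_of_real (Re (h \<zeta>)) * \<zeta> ^ K = poly P \<zeta>" and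
    Q: "\<forall>\<zeta>\<in>sphere 0 1. complex_of_real (Im (h \<zeta>)) * \<zeta> ^ L = poly Q \<zeta>"
    by auto
  let ?R = "P * monom 1 L + smult \<i> (Q * monom 1 K)"
  have "norm (poly ?R \<zeta> - g \<zeta> * \<zeta> ^ (K + L)) < e" if "\<zeta> \<in> S" for \<zeta>
  proof -
    have \<zeta>: "\<zeta> \<in> sphere 0 1" using that S by blast
    then have "poly ?R \<zeta> = (Re (h \<zeta>) + \<i> * Im (h \<zeta>)) * \<zeta> ^ (K + L)"
      using P[rule_format, OF \<zeta>, symmetric] Q[rule_format, OF \<zeta>, symmetric]
      by (simp add: poly_monom power_add algebra_simps)
    then have "poly ?R \<zeta> - g \<zeta> * \<zeta> ^ (K + L) = (h \<zeta> - g \<zeta>) * \<zeta> ^ (K + L)"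
      by (simp add: complex_eq[symmetric] left_diff_distrib)
    then show ?thesis
      using \<zeta> close[OF that] by (simp add: norm_mult norm_power norm_minus_commute)
  qed
  then show ?thesis by blast
qed

lemma (in finite_measure) convergence_in_measure:
  fixes k :: "nat \<Rightarrow> 'a \<Rightarrow> complex"
  assumes [measurable]: "\<And>n. k n \<in> borel_measurable M" "h \<in> borel_measurable M"
    and lim: "AE x in M. (\<lambda>n. k n x) \<longlonglongrightarrow> h x" and "e > 0" "d > 0"
  shows "\<exists>n. measure M {x \<in> space M. e \<le> norm (k n x - h x)} < d"
proof -
  define A where "A n = {x \<in> space M. e \<le> norm (k n x - h x)}" for n
  define B where "B n = (\<Union>m\<in>{n..}. A m)" for n
  have [measurable]: "A n \<in> sets M" "B n \<in> sets M" for n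
    unfolding A_def B_def by measurable
  have "AE x in M. x \<notin> (\<Inter>n. B n)"
    using lim
  proof eventually_elim
    case (elim x)
    then have "\<forall>\<^sub>F n in sequentially. dist (k n x) (h x) < e"
      using \<open>e > 0\<close> by (rule tendstoD)
    then obtain n where "\<And>m. m \<ge> n \<Longrightarrow> norm (k m x - h x) < e"
      by (auto simp: eventually_sequentially dist_norm)
    then have "x \<notin> B n" by (fastforce simp: A_def B_def)
    then show ?case by blast
  qed
  then have "(\<Inter>n. B n) \<in> null_sets M"
    by (subst AE_iff_null_sets) auto
  then have "measure M (\<Inter>n. B n) = 0"
    by (simp add: measure_eq_emeasure_eq_ennreal[of 0] null_setsD1)
  moreover have "(\<lambda>n. measure M (B n)) \<longlonglongrightarrow> measure M (\<Inter>n. B n)"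
    by (rule finite_Lim_measure_decseq) (auto simp: decseq_def B_def, force)
  ultimately have "\<forall>\<^sub>F n in sequentially. measure M (B n) < d"
    using \<open>d > 0\<close> by (simp add: order_tendstoD(2))
  then obtain n where "measure M (B n) < d"
    by (auto simp: eventually_sequentially)
  moreover have "measure M (A n) \<le> measure M (B n)"
    by (rule finite_measure_mono) (auto simp: B_def)
  ultimately show ?thesis unfolding A_def by (meson le_less_trans)
qed

text \<open>In the parameter \<open>t\<close> a measurable function is an almost everywhere limit of continuous ones,
hence close to one of them in measure. That continuous function need not be periodic; removing a short
arc before the point \<open>1\<close> leaves a compact arc on which the angle is continuous, where the
uniform approximation applies.\<close>

lemma trig_polynomial_approximation_in_measure:
  fixes g :: "complex \<Rightarrow> complex"
  assumes g [measurable]: "g \<in> borel_measurable circle_borel" and "e > 0"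
  shows "\<exists>P K. measure circle_borel
    {\<zeta> \<in> sphere 0 1. e \<le> norm (poly P \<zeta> - g \<zeta> * \<zeta> ^ K)} \<le> e"
proof -
  let ?T = "{0..<2 * pi}"
  let ?M = "restrict_space lborel ?T"
  interpret M: finite_measure ?M by (rule finite_measure_circle_parameter)
  define h where "h t = g (cis t)" for t
  have h [measurable]: "h \<in> borel_measurable ?M"
    unfolding h_def using cis_measurable_circle_borel by measurable
  then have "h \<in> borel_measurable (lebesgue_on ?T)"
    by (subst (asm) borel_measurable_restrict_space_iff, simp, subst borel_measurable_restrict_space_iff)
       (auto intro: measurable_completion)
  then have "h measurable_on ?T"
    by (subst measurable_on_iff_borel_measurable) auto
  then obtain N k where N: "negligible N" and k: "\<And>n. continuous_on UNIV (k n)"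
    and lim: "\<And>t. t \<notin> N \<Longrightarrow> (\<lambda>n. k n t) \<longlonglongrightarrow> (if t \<in> ?T then h t else 0)"
    unfolding measurable_on_def by blast
  have "k n \<in> borel_measurable lborel" for n
    using borel_measurable_continuous_onI[OF k] by simp
  then have km [measurable]: "k n \<in> borel_measurable ?M" for n
    by (rule measurable_restrict_space1)
  have "AE t in lebesgue. t \<notin> N"
    using N by (auto simp: negligible_iff_null_sets intro: AE_not_in)
  then have "AE t in lborel. t \<notin> N"
    by (simp add: AE_completion_iff)
  then have "AE t in ?M. (\<lambda>n. k n t) \<longlonglongrightarrow> h t"
    by (subst AE_restrict_space_iff) (auto elim!: eventually_mono dest: lim)
  from M.convergence_in_measure[OF km h this, of "e / 2" "e / 2"] obtain n where
    n: "measure ?M {t \<in> space ?M. e / 2 \<le> norm (k n t - h t)} < e / 2"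
    using \<open>e > 0\<close> by auto
  define d where "d = min (e / 2) pi"
  have d: "0 < d" "d \<le> e / 2" "d \<le> pi" using \<open>e > 0\<close> by (auto simp: d_def)
  let ?I = "{0..2 * pi - d}"
  have inv: "\<forall>t\<in>?I. Arg2pi (cis t) = t"
    using d by (auto intro!: Arg2pi_unique[of 1] simp: cis_conv_exp)
  have "continuous_on (cis ` ?I) Arg2pi"
    by (rule continuous_on_inv[where f = cis and g = Arg2pi, OF _ _ inv]) (auto intro!: continuous_intros)
  then have "continuous_on (cis ` ?I) (\<lambda>\<zeta>. k n (Arg2pi \<zeta>))"
    by (rule continuous_on_compose2[OF k]) auto
  moreover have "compact (cis ` ?I)"
    by (intro compact_continuous_image continuous_intros) auto
  ultimately obtain P K where
    PK: "\<And>\<zeta>. \<zeta> \<in> cis ` ?I \<Longrightarrow> norm (poly P \<zeta> - k n (Arg2pi \<zeta>) * \<zeta> ^ K) < e / 2"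
    using trig_polynomial_approximation[of "cis ` ?I" "\<lambda>\<zeta>. k n (Arg2pi \<zeta>)" "e / 2"] \<open>e > 0\<close>
    by (auto simp: image_subset_iff)
  let ?A = "{\<zeta> \<in> space circle_borel. e \<le> norm (poly P \<zeta> - g \<zeta> * \<zeta> ^ K)}"
  have A: "?A \<in> sets circle_borel"
  proof -
    have "(\<lambda>\<zeta>. poly P \<zeta>) \<in> borel_measurable circle_borel"
      by (intro borel_measurable_circle_borel borel_measurable_continuous_onI continuous_intros)
    moreover have "(\<lambda>\<zeta>. \<zeta> ^ K) \<in> borel_measurable circle_borel"
      by (intro borel_measurable_circle_borel borel_measurable_continuous_onI continuous_intros)
    ultimately show ?thesis by measurable
  qed
  have sub: "{t \<in> ?T. cis t \<in> ?A} \<subseteq>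
      {t \<in> space ?M. e / 2 \<le> norm (k n t - h t)} \<union> {2 * pi - d<..<2 * pi}"
  proof
    fix t assume *: "t \<in> {t \<in> ?T. cis t \<in> ?A}"
    show "t \<in> {t \<in> space ?M. e / 2 \<le> norm (k n t - h t)} \<union> {2 * pi - d<..<2 * pi}"
    proof (cases "t \<in> {2 * pi - d<..<2 * pi}")
      case False
      with * have t: "t \<in> ?T" "t \<notin> {2 * pi - d<..<2 * pi}" and bad: "cis t \<in> ?A" by auto
      then have "t \<in> ?I" by auto
      then have *: "norm (poly P (cis t) - k n t * cis t ^ K) < e / 2"
        using PK[of "cis t"] inv by auto
      have "norm (poly P (cis t) - h t * cis t ^ K) \<le>
          norm (poly P (cis t) - k n t * cis t ^ K) + norm ((k n t - h t) * cis t ^ K)"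
        using norm_triangle_ineq[of "poly P (cis t) - k n t * cis t ^ K" "(k n t - h t) * cis t ^ K"]
        by (simp add: algebra_simps)
      also have "norm ((k n t - h t) * cis t ^ K) = norm (k n t - h t)"
        by (simp add: norm_mult norm_power)
      finally have "e / 2 \<le> norm (k n t - h t)"
        using * bad by (simp add: h_def)
      then show ?thesis
        using t by (auto simp: space_restrict_space)
    qed simp
  qed
  have Mset: "{t \<in> space ?M. e / 2 \<le> norm (k n t - h t)} \<in> sets ?M" (is "?B \<in> _")
    by measurable
  then have B: "?B \<in> sets lborel"
    by (simp add: sets_restrict_space_iff)
  have BT: "?B \<subseteq> ?T"
    by (auto simp only: space_restrict_space)
  have "measure circle_borel ?A = measure lborel {t \<in> ?T. cis t \<in> ?A}"
    by (rule measure_circle_borel[OF A])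
  also have "\<dots> \<le> measure lborel (?B \<union> {2 * pi - d<..<2 * pi})"
  proof (rule measure_mono_fmeasurable[OF sub])
    show "{t \<in> ?T. cis t \<in> ?A} \<in> sets lborel" by (rule parameter_set_measurable[OF A])
    have "?B \<in> fmeasurable lborel"
      by (rule fmeasurableI2[of ?T, OF _ BT B]) (simp add: fmeasurable_def)
    then show "?B \<union> {2 * pi - d<..<2 * pi} \<in> fmeasurable lborel"
      by (rule fmeasurable.Un) (use d in \<open>simp add: fmeasurable_def\<close>)
  qed
  also have "\<dots> \<le> measure lborel ?B + measure lborel {2 * pi - d<..<2 * pi}"
    by (rule measure_Un_le[OF B]) simp
  also have "measure lborel ?B = measure ?M ?B"
    by (rule measure_restrict_space[OF _ BT, symmetric]) simp
  also have "measure lborel {2 * pi - d<..<2 * pi} = d"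
    using d by simp
  finally show ?thesis
    using n d unfolding space_circle_borel by (intro exI[of _ P] exI[of _ K]) linarith
qed

section \<open>Powers near the roots of unity\<close>

text \<open>A Jordan-type inequality. The chord length on the right is \<open>2 * \<bar>sin (x / 2)\<bar>\<close>, which is bounded below by the cubic
Taylor estimate of the sine on \<open>\<bar>x / 2\<bar> \<le> 2\<close>.\<close>

lemma norm_one_minus_cis_ge:
  assumes "\<bar>x\<bar> \<le> pi"
  shows "\<bar>x\<bar> / 3 \<le> norm (1 - cis x)"
proof -
  let ?y = "\<bar>x\<bar> / 2"
  have "?y \<le> 2" using assms pi_less_4 by simp
  then have "?y * ?y \<le> 4"
    using mult_mono[of ?y 2 ?y 2] by simp
  then have "?y * (?y * ?y) \<le> ?y * 4" by (intro mult_left_mono) auto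
  moreover have "\<bar>sin ?y - ?y\<bar> \<le> ?y * (?y * ?y) / 6"
  proof -
    have "(\<Sum>m<3. sin_coeff m * ?y ^ m) = ?y"
      by (simp add: sin_coeff_def numeral_3_eq_3)
    then have "\<bar>sin ?y - ?y\<bar> \<le> inverse (fact 3) * \<bar>?y\<bar> ^ 3"
      using Maclaurin_sin_bound[of ?y 3] by argo
    also have "\<dots> = ?y * (?y * ?y) / 6"
      by (simp add: power3_eq_cube fact_numeral)
    finally show ?thesis .
  qed
  ultimately have "sin ?y \<ge> ?y / 3" by linarith
  moreover have "norm (1 - cis x) = 2 * \<bar>sin (x / 2)\<bar>"
    using dist_exp_i_1[of x] by (simp add: cis_conv_exp norm_minus_commute)
  moreover have "\<bar>sin (x / 2)\<bar> \<ge> sin ?y"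
    by (cases "x \<ge> 0") (auto simp: abs_if)
  ultimately show ?thesis by linarith
qed

text \<open>The set is covered by arcs around the \<open>N\<close>-th roots of unity, whose number grows like \<open>N\<close> and
whose length shrinks like \<open>\<tau> / N\<close>. So the bound is uniform in \<open>N\<close>. The index \<open>j = N\<close> of the
covering accounts for parameters just below \<open>2 * pi\<close>.\<close>

lemma measure_near_roots_of_unity_le:
  assumes "N > 0" and "\<tau> > 0"
  shows "{\<zeta> \<in> sphere 0 1. norm (1 - \<zeta> ^ N) < \<tau>} \<in> sets circle_borel" (is "?A \<in> _")
    and "measure circle_borel {\<zeta> \<in> sphere 0 1. norm (1 - \<zeta> ^ N) < \<tau>} \<le> 12 * \<tau>"
proof -
  have "(\<lambda>\<zeta>::complex. norm (1 - \<zeta> ^ N)) \<in> borel_measurable circle_borel"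
    by (intro borel_measurable_circle_borel borel_measurable_continuous_onI continuous_intros)
  then have "{\<zeta> \<in> space circle_borel. norm (1 - \<zeta> ^ N) < \<tau>} \<in> sets circle_borel"
    by measurable
  then show A: "?A \<in> sets circle_borel" by simp
  define J where "J j = {2 * pi * real j / N - 3 * \<tau> / N..2 * pi * real j / N + 3 * \<tau> / N}" for j
  have sub: "{t \<in> {0..<2 * pi}. cis t \<in> ?A} \<subseteq> (\<Union>j\<in>{..N}. J j)"
  proof
    fix t assume "t \<in> {t \<in> {0..<2 * pi}. cis t \<in> ?A}"
    then have t: "0 \<le> t" "t < 2 * pi" and small: "norm (1 - cis (N * t)) < \<tau>"
      by (auto simp: Complex.DeMoivre)
    define y where "y = N * t / (2 * pi)"
    define j where "j = nat (round y)"
    have "N * t \<le> N * (2 * pi)"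
      using t by (intro mult_left_mono) auto
    then have "0 \<le> y" and "y \<le> N"
      using t by (auto simp: y_def divide_le_eq)
    then have "0 \<le> round y" "round y \<le> int N"
      using round_mono[of 0 y] round_mono[of y "of_nat N"] by auto
    then have j: "real j = of_int (round y)" "j \<le> N" by (auto simp: j_def)
    define x where "x = N * t - 2 * pi * real j"
    have "\<bar>y - real j\<bar> \<le> 1 / 2"
      using of_int_round_abs_le[of y] by (simp add: j abs_minus_commute)
    moreover have x: "x = 2 * pi * (y - real j)"
      by (simp add: x_def y_def field_simps)
    ultimately have "\<bar>x\<bar> \<le> pi"
      by (simp add: abs_mult)
    moreover have "cis x = cis (N * t)"
    proof -
      have "cis (2 * pi * real j) = 1"
        by (metis Complex.DeMoivre cis_2pi mult.commute power_one)
      then show ?thesis by (simp add: x_def flip: cis_divide)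
    qed
    ultimately have "\<bar>x\<bar> < 3 * \<tau>"
      using norm_one_minus_cis_ge[of x] small by simp
    then have "t \<in> J j"
      using \<open>N > 0\<close> by (auto simp: J_def x_def field_simps abs_less_iff)
    then show "t \<in> (\<Union>j\<in>{..N}. J j)" using j by blast
  qed
  have "measure circle_borel ?A = measure lborel {t \<in> {0..<2 * pi}. cis t \<in> ?A}"
    by (rule measure_circle_borel[OF A])
  also have "\<dots> \<le> measure lborel (\<Union>j\<in>{..N}. J j)"
    by (rule measure_mono_fmeasurable[OF sub parameter_set_measurable[OF A]])
       (intro fmeasurable.finite_UN, simp_all add: J_def fmeasurable_def emeasure_lborel_Icc_eq)
  also have "\<dots> \<le> (\<Sum>j\<in>{..N}. measure lborel (J j))"
    by (rule measure_UNION_le) (auto simp: J_def)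
  also have "\<dots> = (N + 1) * (6 * \<tau> / N)"
    using \<open>\<tau> > 0\<close> by (simp add: J_def field_simps)
  also have "\<dots> \<le> 12 * \<tau>"
    using assms by (simp add: field_simps)
  finally show "measure circle_borel ?A \<le> 12 * \<tau>" .
qed

lemma AE_not_root_of_unity:
  assumes "N > 0"
  shows "AE \<zeta> in circle_borel. \<zeta> ^ N \<noteq> 1"
proof -
  let ?Z = "{\<zeta> \<in> sphere 0 1. \<zeta> ^ N = (1::complex)}"
  have "finite ?Z"
    by (rule finite_subset[OF _ finite_roots_unity[of N]]) (use assms in auto)
  have Z: "?Z \<in> sets circle_borel"
  proof -
    have "?Z \<in> sets borel" using \<open>finite ?Z\<close> by (simp add: finite_imp_closed)
    then show ?thesis by (subst sets_circle_borel, subst sets_restrict_space_iff) auto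
  qed
  have bound: "measure circle_borel ?Z \<le> 12 * \<tau>" if "\<tau> > 0" for \<tau>
  proof -
    have "measure circle_borel ?Z \<le> measure circle_borel {\<zeta> \<in> sphere 0 1. norm (1 - \<zeta> ^ N) < \<tau>}"
      by (rule circle.finite_measure_mono)
        (use that measure_near_roots_of_unity_le(1)[OF assms that] in auto)
    also have "\<dots> \<le> 12 * \<tau>" by (rule measure_near_roots_of_unity_le(2)[OF assms that])
    finally show ?thesis .
  qed
  have "measure circle_borel ?Z \<le> 0"
  proof (rule field_le_epsilon)
    fix e :: real assume "e > 0"
    then show "measure circle_borel ?Z \<le> 0 + e"
      using bound[of "e / 12"] by simp
  qed
  then have "?Z \<in> null_sets circle_borel"
    using Z by (simp add: null_sets_def circle.emeasure_eq_measure measure_le_0_iff)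
  from AE_not_in[OF this] AE_space show ?thesis
    by eventually_elim auto
qed

section \<open>A single correction\<close>

text \<open>\<open>- 2 * \<omega> / (1 - \<omega>)\<close> is \<open>1\<close> minus the Cayley transform \<open>(1 + \<omega>) / (1 - \<omega>)\<close>, which maps the circle
to the imaginary axis.\<close>

lemma Re_minus_2_mult_div_one_minus:
  assumes "norm \<omega> = 1" and "\<omega> \<noteq> 1"
  shows "Re (- 2 * \<omega> / (1 - \<omega>)) = 1"
proof -
  have "cnj \<omega> * \<omega> = 1"
    using assms(1) by (simp add: complex_norm_square[symmetric] mult.commute)
  then have 1: "cnj \<omega> = 1 / \<omega>" and "\<omega> \<noteq> 0"
    by (metis nonzero_eq_divide_eq mult_zero_right zero_neq_one, force)
  let ?G = "- 2 * \<omega> / (1 - \<omega>)"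
  have "?G + cnj ?G = 2"
    using assms(2) \<open>\<omega> \<noteq> 0\<close> by (simp add: 1 divide_simps) (simp add: algebra_simps)
  then have "complex_of_real (2 * Re ?G) = complex_of_real 2"
    by (metis complex_add_cnj of_real_numeral)
  then show ?thesis by (simp only: of_real_eq_iff)
qed

text \<open>This is the estimate of \<open>q z * G (z ^ N)\<close> in a Stolz angle, for \<open>q z = P z / z ^ K\<close>,
\<open>G w = - 2 * w / (1 - w)\<close> and \<open>N = m + K\<close>. It is as good as if \<open>P\<close> were constant in the Stolz angle:
at distance at least \<open>s\<close> from the circle the factor \<open>z ^ m\<close> is tiny, and closer to the circle
\<open>z\<close> is so near to \<open>\<zeta>\<close> that uniform continuity of \<open>P\<close> applies.\<close>

lemma spike_multiple_bound:
  fixes P :: "complex poly"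
  assumes "M \<ge> 0" and "\<tau> > 0" and "\<eta> > 0"
  shows "\<exists>m>0. \<forall>\<zeta>\<in>sphere 0 1. \<tau> \<le> norm (1 - \<zeta> ^ (m + K)) \<longrightarrow>
    (\<forall>z\<in>stolz_angle \<zeta> M.
      norm (- 2 * poly P z * z ^ m / (1 - z ^ (m + K))) \<le> (norm (poly P \<zeta>) + \<eta>) * (2 * (1 + M) / \<tau>))"
proof -
  have P: "continuous_on (cball 0 1) (poly P)" by (intro continuous_intros)
  then have "uniformly_continuous_on (cball 0 1) (poly P)"
    by (rule compact_uniformly_continuous) simp
  then obtain d where "d > 0" and d: "\<And>z w. z \<in> cball 0 1 \<Longrightarrow> w \<in> cball 0 1 \<Longrightarrow> dist z w < d
      \<Longrightarrow> dist (poly P z) (poly P w) < \<eta>"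
    using \<open>\<eta> > 0\<close> unfolding uniformly_continuous_on_def by metis
  define s where "s = min 1 (d / (M + 1))"
  have s: "0 < s" "s \<le> 1" using \<open>d > 0\<close> \<open>M \<ge> 0\<close> by (auto simp: s_def)
  have "M * s \<le> M * (d / (M + 1))"
    using \<open>M \<ge> 0\<close> by (intro mult_left_mono) (auto simp: s_def)
  also have "\<dots> < d" using \<open>d > 0\<close> \<open>M \<ge> 0\<close> by (simp add: field_simps)
  finally have Ms: "M * s < d" .
  have "bounded (poly P ` cball 0 1)"
    by (intro compact_imp_bounded compact_continuous_image P) auto
  then obtain B where "B > 0" and B: "\<And>z. z \<in> cball 0 1 \<Longrightarrow> norm (poly P z) \<le> B"
    by (auto simp: bounded_pos)
  obtain k where k: "(1 - s) ^ k < \<eta> / B"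
    using real_arch_pow_inv[of "\<eta> / B" "1 - s"] s \<open>B > 0\<close> \<open>\<eta> > 0\<close> by auto
  define m where "m = Suc k"
  have "(1 - s) ^ m \<le> (1 - s) ^ k" using s by (intro power_decreasing) (auto simp: m_def)
  then have "B * (1 - s) ^ m \<le> B * (1 - s) ^ k"
    using \<open>B > 0\<close> by (intro mult_left_mono) auto
  also have "\<dots> < \<eta>" using k \<open>B > 0\<close> by (simp add: field_simps)
  finally have m: "B * (1 - s) ^ m \<le> \<eta>" by simp
  have "norm (- 2 * poly P z * z ^ m / (1 - z ^ (m + K))) \<le> (norm (poly P \<zeta>) + \<eta>) * (2 * (1 + M) / \<tau>)"
    if \<zeta>: "\<zeta> \<in> sphere 0 1" and \<tau>: "\<tau> \<le> norm (1 - \<zeta> ^ (m + K))" and z: "z \<in> stolz_angle \<zeta> M" for \<zeta> z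
  proof -
    have z1: "norm z < 1" and zM: "norm (z - \<zeta>) \<le> M * (1 - norm z)"
      using z by (auto simp: stolz_angle_iff)
    have "z ^ (m + K) \<in> stolz_angle (\<zeta> ^ (m + K)) M"
      using \<zeta> by (intro power_in_stolz_angle[OF z]) (auto simp: m_def)
    from norm_one_minus_stolz_angle[OF this \<open>M \<ge> 0\<close>] \<tau>
    have den: "\<tau> \<le> (1 + M) * norm (1 - z ^ (m + K))" by linarith
    then have "norm (1 - z ^ (m + K)) > 0"
      using \<open>\<tau> > 0\<close> \<open>M \<ge> 0\<close> by (smt (verit) mult_nonneg_nonpos norm_ge_zero)
    then have inv: "2 / norm (1 - z ^ (m + K)) \<le> 2 * (1 + M) / \<tau>"
      using den \<open>\<tau> > 0\<close> by (simp add: field_simps)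
    have num: "norm (poly P z) * norm z ^ m \<le> norm (poly P \<zeta>) + \<eta>"
    proof (cases "norm z \<le> 1 - s")
      case True
      then have "norm (poly P z) * norm z ^ m \<le> B * (1 - s) ^ m"
        using B[of z] z1 \<open>B > 0\<close> by (intro mult_mono power_mono) auto
      then show ?thesis using m norm_ge_zero[of "poly P \<zeta>"] by linarith
    next
      case False
      then have "M * (1 - norm z) \<le> M * s" using \<open>M \<ge> 0\<close> by (intro mult_left_mono) auto
      then have "dist z \<zeta> < d" using zM Ms by (simp add: dist_norm)
      then have "dist (poly P z) (poly P \<zeta>) < \<eta>" using z1 \<zeta> by (intro d) auto
      then have "norm (poly P z) \<le> norm (poly P \<zeta>) + \<eta>"
        using norm_triangle_ineq2[of "poly P z" "poly P \<zeta>"] by (simp add: dist_norm)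
      moreover have "norm (poly P z) * norm z ^ m \<le> norm (poly P z) * 1"
        using z1 by (intro mult_left_mono power_le_one) auto
      ultimately show ?thesis by simp
    qed
    have "norm (- 2 * poly P z * z ^ m / (1 - z ^ (m + K))) =
        (norm (poly P z) * norm z ^ m) * (2 / norm (1 - z ^ (m + K)))"
      by (simp add: norm_mult norm_divide norm_power)
    also have "\<dots> \<le> (norm (poly P \<zeta>) + \<eta>) * (2 * (1 + M) / \<tau>)"
      using num inv \<open>\<eta> > 0\<close> by (intro mult_mono) auto
    finally show ?thesis .
  qed
  then show ?thesis by (intro exI[of _ m]) (auto simp: m_def)
qed

text \<open>Off the exceptional set \<open>E\<close>, the function \<open>f\<close> solves the boundary problem for the residual \<open>\<psi>\<close>
with error \<open>t\<close>, and it costs at most \<open>\<delta>\<close> on the Stolz angle wherever the residual is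
below the threshold \<open>\<kappa>\<close>.\<close>

definition correction ::
  "(complex \<Rightarrow> complex) \<Rightarrow> real \<Rightarrow> real \<Rightarrow> real \<Rightarrow> (complex \<Rightarrow> real) \<Rightarrow> real \<Rightarrow>
    (complex \<Rightarrow> complex) \<Rightarrow> complex set \<Rightarrow> bool" where
  "correction \<nu> M \<delta> \<kappa> \<psi> t f E \<longleftrightarrow>
    f holomorphic_on ball 0 1 \<and> f \<in> borel_measurable borel \<and> (AE \<zeta> in circle_borel. isCont f \<zeta>) \<and>
    E \<in> sets circle_borel \<and>
    (\<forall>\<zeta>\<in>sphere 0 1 - E. \<bar>Re (\<nu> \<zeta> * f \<zeta>) - \<psi> \<zeta>\<bar> \<le> t \<and>
      (\<bar>\<psi> \<zeta>\<bar> \<le> \<kappa> \<longrightarrow> (\<forall>z\<in>stolz_angle \<zeta> M. norm (f z) \<le> \<delta>)))"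

text \<open>What makes the iteration possible is the order of the quantifiers: the threshold \<open>\<kappa>\<close> depends
neither on \<open>\<psi>\<close> nor on the accuracy \<open>t\<close>. Indeed \<open>\<kappa>\<close> only has to absorb \<open>C\<close>, the bound
of \<open>G (z ^ N)\<close> on Stolz angles at points \<open>\<zeta>\<close> with \<open>norm (1 - \<zeta> ^ N) \<ge> \<tau>\<close>, and \<open>\<tau>\<close> is
dictated by the measure \<open>\<epsilon>\<close> alone.\<close>

lemma ex_correction:
  assumes \<nu> [measurable]: "\<nu> \<in> borel_measurable circle_borel"
    and norm_\<nu>: "\<And>\<zeta>. \<zeta> \<in> sphere 0 1 \<Longrightarrow> norm (\<nu> \<zeta>) = 1"
    and "M \<ge> 0" and "\<epsilon> > 0" and "\<delta> > 0"
  shows "\<exists>\<kappa>>0. \<forall>\<psi>\<in>borel_measurable circle_borel. \<forall>t>0.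
    \<exists>f E. correction \<nu> M \<delta> \<kappa> \<psi> t f E \<and> measure circle_borel E \<le> \<epsilon>"
proof -
  \<comment> \<open>The points with \<open>norm (1 - \<zeta> ^ N) < \<tau>\<close> have measure at most \<open>12 * \<tau>\<close>, half of \<open>\<epsilon>\<close>.\<close>
  define \<tau> where "\<tau> = \<epsilon> / 24"
  define C where "C = 2 * (1 + M) / \<tau>"
  \<comment> \<open>Three terms of size \<open>\<kappa>\<close> share \<open>\<delta>\<close>: the residual, its approximation error and the slack \<open>\<eta>\<close> of \<open>spike_multiple_bound\<close>.\<close>
  define \<kappa> where "\<kappa> = \<delta> / (3 * C)"
  have "\<tau> > 0" using \<open>\<epsilon> > 0\<close> by (simp add: \<tau>_def)
  then have "C > 0" using \<open>M \<ge> 0\<close> by (simp add: C_def)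
  then have "\<kappa> > 0" using \<open>\<delta> > 0\<close> by (simp add: \<kappa>_def)
  have "\<exists>f E. correction \<nu> M \<delta> \<kappa> \<psi> t f E \<and> measure circle_borel E \<le> \<epsilon>"
    if \<psi> [measurable]: "\<psi> \<in> borel_measurable circle_borel" and "t > 0" for \<psi> t
  proof -
    define e where "e = min (\<epsilon> / 2) (min \<kappa> (t * \<tau> / 2))"
    have e: "0 < e" "e \<le> \<epsilon> / 2" "e \<le> \<kappa>" "e \<le> t * \<tau> / 2"
      using \<open>\<epsilon> > 0\<close> \<open>\<kappa> > 0\<close> \<open>\<tau> > 0\<close> \<open>t > 0\<close> by (auto simp: e_def)
    \<comment> \<open>Since \<open>norm (\<nu> \<zeta>) = 1\<close>, this is the function with \<open>\<nu> * g = \<psi>\<close>.\<close>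
    define g where "g \<zeta> = of_real (\<psi> \<zeta>) * cnj (\<nu> \<zeta>)" for \<zeta>
    have "cnj \<in> borel_measurable borel"
      by (intro borel_measurable_continuous_onI continuous_intros)
    then have g [measurable]: "g \<in> borel_measurable circle_borel"
      unfolding g_def by measurable
    obtain P K where PK: "measure circle_borel
        {\<zeta> \<in> sphere 0 1. e \<le> norm (poly P \<zeta> - g \<zeta> * \<zeta> ^ K)} \<le> e"
      using trig_polynomial_approximation_in_measure[OF g e(1)] by blast
    obtain m where "m > 0" and m: "\<And>\<zeta> z. \<zeta> \<in> sphere 0 1 \<Longrightarrow> \<tau> \<le> norm (1 - \<zeta> ^ (m + K)) \<Longrightarrow>
        z \<in> stolz_angle \<zeta> M \<Longrightarrow>
        norm (- 2 * poly P z * z ^ m / (1 - z ^ (m + K))) \<le> (norm (poly P \<zeta>) + \<kappa>) * C"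
      unfolding C_def using spike_multiple_bound[OF \<open>M \<ge> 0\<close> \<open>\<tau> > 0\<close> \<open>\<kappa> > 0\<close>, of K P] by blast
    define N where "N = m + K"
    have "N > 0" using \<open>m > 0\<close> by (simp add: N_def)
    define f where "f z = - 2 * poly P z * z ^ m / (1 - z ^ N)" for z
    define E1 where "E1 = {\<zeta> \<in> sphere 0 1. e \<le> norm (poly P \<zeta> - g \<zeta> * \<zeta> ^ K)}"
    define E2 where "E2 = {\<zeta> \<in> sphere (0::complex) 1. norm (1 - \<zeta> ^ N) < \<tau>}"
    have poly_meas: "poly P \<in> borel_measurable borel" and pow_meas: "(\<lambda>z::complex. z ^ j) \<in> borel_measurable borel" for j
      by (intro borel_measurable_continuous_onI continuous_intros)+
    have "{\<zeta> \<in> space circle_borel. e \<le> norm (poly P \<zeta> - g \<zeta> * \<zeta> ^ K)} \<in> sets circle_borel"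
      using poly_meas[THEN borel_measurable_circle_borel] pow_meas[THEN borel_measurable_circle_borel, of K]
      by measurable
    then have E1: "E1 \<in> sets circle_borel" by (simp add: E1_def)
    have E2: "E2 \<in> sets circle_borel" and "measure circle_borel E2 \<le> 12 * \<tau>"
      unfolding E2_def by (rule measure_near_roots_of_unity_le[OF \<open>N > 0\<close> \<open>\<tau> > 0\<close>])+
    then have "measure circle_borel (E1 \<union> E2) \<le> e + 12 * \<tau>"
      using measure_Un_le[OF E1 E2] PK by (simp add: E1_def)
    then have small: "measure circle_borel (E1 \<union> E2) \<le> \<epsilon>"
      using e by (simp add: \<tau>_def)
    have hol: "f holomorphic_on ball 0 1"
    proof -
      have "1 - z ^ N \<noteq> 0" if "z \<in> ball 0 1" for z :: complex
      proof
        assume "1 - z ^ N = 0"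
        then have "norm z ^ N = 1" by (metis eq_iff_diff_eq_0 norm_one norm_power)
        moreover have "norm z ^ N < 1" using that \<open>N > 0\<close> by (simp add: power_less_one_iff)
        ultimately show False by simp
      qed
      then show ?thesis unfolding f_def by (intro holomorphic_intros) auto
    qed
    have meas: "f \<in> borel_measurable borel"
      unfolding f_def using poly_meas pow_meas by measurable
    have cont: "AE \<zeta> in circle_borel. isCont f \<zeta>"
      using AE_not_root_of_unity[OF \<open>N > 0\<close>]
      by eventually_elim (auto simp: f_def[abs_def] intro!: continuous_intros)
    have bound: "\<bar>Re (\<nu> \<zeta> * f \<zeta>) - \<psi> \<zeta>\<bar> \<le> t" "\<bar>\<psi> \<zeta>\<bar> \<le> \<kappa> \<Longrightarrow> z \<in> stolz_angle \<zeta> M \<Longrightarrow> norm (f z) \<le> \<delta>"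
      if \<zeta>: "\<zeta> \<in> sphere 0 1 - (E1 \<union> E2)" for \<zeta> z
    proof -
      have 1: "norm \<zeta> = 1" "norm (\<nu> \<zeta>) = 1" using \<zeta> norm_\<nu> by auto
      have close: "norm (poly P \<zeta> - g \<zeta> * \<zeta> ^ K) < e" and far: "\<tau> \<le> norm (1 - \<zeta> ^ N)"
        using \<zeta> by (auto simp: E1_def E2_def not_le not_less)
      define G where "G = - 2 * \<zeta> ^ N / (1 - \<zeta> ^ N)"
      have "\<zeta> ^ N \<noteq> 1" using far \<open>\<tau> > 0\<close> by auto
      then have ReG: "Re G = 1"
        unfolding G_def using 1 by (intro Re_minus_2_mult_div_one_minus) (auto simp: norm_power)
      have normG: "norm G \<le> 2 / \<tau>"
        using far \<open>\<tau> > 0\<close> 1 by (simp add: G_def norm_divide norm_mult norm_power frac_le)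
      have "w * cnj w = 1" if "norm w = 1" for w :: complex
        using that by (simp add: complex_norm_square[symmetric])
      from this[of "\<nu> \<zeta>"] this[of "\<zeta> ^ K"]
      have unit: "\<nu> \<zeta> * cnj (\<nu> \<zeta>) = 1" "cnj (\<zeta> ^ K) * \<zeta> ^ K = 1"
        using 1 by (simp_all only: norm_power power_one mult.commute)
      \<comment> \<open>\<open>r\<close> is the error \<open>\<nu> * q - \<psi>\<close>, where \<open>q \<zeta> = P \<zeta> / \<zeta> ^ K\<close>.\<close>
      define r where "r = \<nu> \<zeta> * cnj (\<zeta> ^ K) * (poly P \<zeta> - g \<zeta> * \<zeta> ^ K)"
      have "f \<zeta> = poly P \<zeta> * (cnj (\<zeta> ^ K) * \<zeta> ^ K) * (- 2 * \<zeta> ^ m / (1 - \<zeta> ^ N))"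
        unfolding unit(2) by (simp add: f_def)
      also have "\<dots> = poly P \<zeta> * cnj (\<zeta> ^ K) * G"
        by (simp add: G_def N_def power_add mult_ac)
      finally have "\<nu> \<zeta> * f \<zeta> = (r + \<psi> \<zeta> * ((\<nu> \<zeta> * cnj (\<nu> \<zeta>)) * (cnj (\<zeta> ^ K) * \<zeta> ^ K))) * G"
        by (simp add: r_def g_def algebra_simps)
      then have "\<nu> \<zeta> * f \<zeta> = r * G + \<psi> \<zeta> * G" by (simp only: unit distrib_right mult_1_right)
      then have "Re (\<nu> \<zeta> * f \<zeta>) - \<psi> \<zeta> = Re (r * G)"
        by (simp add: ReG del: times_complex.simps)
           (simp add: ReG)
      moreover have "norm (r * G) \<le> e * (2 / \<tau>)"
        using close normG e 1 unfolding norm_mult by (intro mult_mono) (auto simp: r_def norm_mult norm_power)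
      moreover have "e * (2 / \<tau>) \<le> t" using e(4) \<open>\<tau> > 0\<close> by (simp add: field_simps)
      ultimately show "\<bar>Re (\<nu> \<zeta> * f \<zeta>) - \<psi> \<zeta>\<bar> \<le> t"
        using abs_Re_le_cmod[of "r * G"] by linarith
      assume \<psi>\<kappa>: "\<bar>\<psi> \<zeta>\<bar> \<le> \<kappa>" and z: "z \<in> stolz_angle \<zeta> M"
      have "norm (poly P \<zeta>) \<le> norm (g \<zeta> * \<zeta> ^ K) + e"
        using norm_triangle_ineq2[of "poly P \<zeta>" "g \<zeta> * \<zeta> ^ K"] close by linarith
      also have "norm (g \<zeta> * \<zeta> ^ K) = \<bar>\<psi> \<zeta>\<bar>"
        using 1 by (simp add: g_def norm_mult norm_power)
      finally have "norm (poly P \<zeta>) + \<kappa> \<le> 3 * \<kappa>" using \<psi>\<kappa> e by linarith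
      then have "(norm (poly P \<zeta>) + \<kappa>) * C \<le> 3 * \<kappa> * C"
        using \<open>C > 0\<close> by (intro mult_right_mono) auto
      also have "\<dots> = \<delta>"
        using \<open>C > 0\<close> by (simp add: \<kappa>_def)
      finally show "norm (f z) \<le> \<delta>"
        using m[OF _ _ z] \<zeta> far unfolding f_def N_def by force
    qed
    have "correction \<nu> M \<delta> \<kappa> \<psi> t f (E1 \<union> E2)"
      unfolding correction_def using hol meas cont E1 E2 bound by blast
    then show ?thesis using small by blast
  qed
  then show ?thesis using \<open>\<kappa> > 0\<close> by blast
qed

section \<open>Summing the corrections\<close>

text \<open>The thresholds \<open>\<kappa> n\<close> are fixed in advance, and the accuracy \<open>t n\<close> of step \<open>n\<close> is chosen below
\<open>\<kappa> (n + 1)\<close>. Then a point outside \<open>E n\<close> has a residual small enough for the correction of step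
\<open>n + 1\<close> to be small on its Stolz angle, unless the point lies in \<open>E (n + 1)\<close>.\<close>

lemma ex_holomorphic_with_Re_limit:
  fixes \<phi> :: "complex \<Rightarrow> real"
  assumes \<nu> [measurable]: "\<nu> \<in> borel_measurable circle_borel"
    and norm_\<nu>: "\<And>\<zeta>. \<zeta> \<in> sphere 0 1 \<Longrightarrow> norm (\<nu> \<zeta>) = 1"
    and \<phi> [measurable]: "\<phi> \<in> borel_measurable circle_borel"
  shows "\<exists>F. F holomorphic_on ball 0 1 \<and>
    (AE \<zeta> in circle_borel. \<forall>M. ((\<lambda>z. Re (\<nu> \<zeta> * F z)) \<longlongrightarrow> \<phi> \<zeta>) (at \<zeta> within stolz_angle \<zeta> M))"
proof -
  have "\<forall>n. \<exists>\<kappa>>0. \<forall>\<psi>\<in>borel_measurable circle_borel. \<forall>t>0. \<exists>f E.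
      correction \<nu> (real n) ((1 / 2) ^ n) \<kappa> \<psi> t f E \<and> measure circle_borel E \<le> (1 / 2) ^ n"
    by (intro allI ex_correction[OF \<nu> norm_\<nu>]) auto
  then obtain \<kappa> where \<kappa>: "\<And>n::nat. \<kappa> n > 0" and
    corr: "\<And>n \<psi> t. \<psi> \<in> borel_measurable circle_borel \<Longrightarrow> t > 0 \<Longrightarrow> \<exists>f E.
      correction \<nu> (real n) ((1 / 2) ^ n) (\<kappa> n) \<psi> t f E \<and> measure circle_borel E \<le> (1 / 2) ^ n"
    by metis
  define t where "t n = min (\<kappa> (Suc n)) ((1 / 2) ^ n)" for n
  have "t n > 0" for n using \<kappa> by (simp add: t_def)
  define \<psi> where "\<psi> S \<zeta> = \<phi> \<zeta> - Re (\<nu> \<zeta> * S \<zeta>)" for S \<zeta>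
  have \<psi>: "\<psi> S \<in> borel_measurable circle_borel" if "S \<in> borel_measurable circle_borel" for S
    unfolding \<psi>_def using that by measurable
  \<comment> \<open>A state consists of the sum \<open>S\<close> of the earlier corrections, the new correction and its exceptional set.\<close>
  define step where "step n X \<longleftrightarrow> (case X of (S, f, E) \<Rightarrow>
      S \<in> borel_measurable circle_borel \<and> (n = 0 \<longrightarrow> S = (\<lambda>_. 0)) \<and>
      correction \<nu> (real n) ((1 / 2) ^ n) (\<kappa> n) (\<psi> S) (t n) f E \<and>
      measure circle_borel E \<le> (1 / 2) ^ n)" for n X
  have "\<exists>X. \<forall>n. step n (X n) \<and> fst (X (Suc n)) = (\<lambda>z. fst (X n) z + fst (snd (X n)) z)"
  proof (rule dependent_nat_choice)
    obtain f E where "correction \<nu> (real 0) ((1 / 2) ^ 0) (\<kappa> 0) (\<psi> (\<lambda>_. 0)) (t 0) f E"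
      "measure circle_borel E \<le> (1 / 2) ^ 0"
      using corr[OF \<psi> \<open>t 0 > 0\<close>, of "\<lambda>_. 0" 0] by auto
    then show "\<exists>X. step 0 X"
      by (intro exI[of _ "(\<lambda>_. 0, f, E)"]) (simp add: step_def)
  next
    fix X n assume X: "step n X"
    obtain S f E where [simp]: "X = (S, f, E)" by (cases X)
    have "S \<in> borel_measurable circle_borel" "f \<in> borel_measurable circle_borel"
      using X by (auto simp: step_def correction_def intro: borel_measurable_circle_borel)
    then have S': "(\<lambda>z. S z + f z) \<in> borel_measurable circle_borel" by measurable
    obtain f' E' where "correction \<nu> (real (Suc n)) ((1 / 2) ^ Suc n) (\<kappa> (Suc n)) (\<psi> (\<lambda>z. S z + f z)) (t (Suc n)) f' E'"
      "measure circle_borel E' \<le> (1 / 2) ^ Suc n"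
      using corr[OF \<psi>[OF S'] \<open>t (Suc n) > 0\<close>, of "Suc n"] by blast
    then show "\<exists>Y. step (Suc n) Y \<and> fst Y = (\<lambda>z. fst X z + fst (snd X) z)"
      using S' by (intro exI[of _ "(\<lambda>z. S z + f z, f', E')"]) (simp add: step_def)
  qed
  then obtain X where X: "\<And>n. step n (X n)"
    and next_sum: "\<And>n. fst (X (Suc n)) = (\<lambda>z. fst (X n) z + fst (snd (X n)) z)"
    by blast
  define f where "f n = fst (snd (X n))" for n
  define E where "E n = snd (snd (X n))" for n
  define S where "S n z = (\<Sum>k<n. f k z)" for n z
  have X_eq: "X n = (S n, f n, E n)" for n
  proof -
    have "fst (X n) = S n"
    proof (induction n)
      case 0
      show ?case using X[of 0] by (auto simp: step_def S_def split: prod.splits)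
    next
      case (Suc n)
      then show ?case by (auto simp: next_sum S_def f_def fun_eq_iff)
    qed
    then show ?thesis by (simp add: f_def E_def prod_eq_iff)
  qed
  have c: "correction \<nu> (real n) ((1 / 2) ^ n) (\<kappa> n) (\<psi> (S n)) (t n) (f n) (E n)"
    and E_small: "measure circle_borel (E n) \<le> (1 / 2) ^ n" for n
    using X[of n] by (auto simp: step_def X_eq)
  have hol: "f n holomorphic_on ball 0 1" and cont: "AE \<zeta> in circle_borel. isCont (f n) \<zeta>"
    and E: "E n \<in> sets circle_borel" for n
    using c[of n] by (auto simp: correction_def)
  have residual: "\<bar>\<psi> (S (Suc n)) \<zeta>\<bar> \<le> t n" if "\<zeta> \<in> sphere 0 1 - E n" for \<zeta> n
  proof -
    have "\<bar>Re (\<nu> \<zeta> * f n \<zeta>) - \<psi> (S n) \<zeta>\<bar> \<le> t n"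
      using c[of n] that unfolding correction_def by blast
    moreover have "\<psi> (S (Suc n)) \<zeta> = - (Re (\<nu> \<zeta> * f n \<zeta>) - \<psi> (S n) \<zeta>)"
      by (simp add: \<psi>_def S_def algebra_simps)
    ultimately show ?thesis by simp
  qed
  have f_small: "norm (f (Suc n) z) \<le> (1 / 2) ^ Suc n"
    if "\<zeta> \<in> sphere 0 1" "\<zeta> \<notin> E n" "\<zeta> \<notin> E (Suc n)" "z \<in> stolz_angle \<zeta> (real (Suc n))" for \<zeta> n z
  proof -
    have "\<bar>\<psi> (S (Suc n)) \<zeta>\<bar> \<le> \<kappa> (Suc n)"
      using residual[of \<zeta> n] that by (simp add: t_def)
    then show ?thesis
      using c[of "Suc n"] that unfolding correction_def by blast
  qed
  \<comment> \<open>A compact disk lies in one large Stolz angle at any boundary point, in particular at a nonexceptional one.\<close>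
  have f_small_inside: "norm (f n z) \<le> (1 / 2) ^ n" if "n > 0" "r < 1" "2 \<le> real n * (1 - r)" "norm z \<le> r" for n r z
  proof -
    obtain p where p: "n = Suc p" using \<open>n > 0\<close> by (cases n) auto
    have "measure circle_borel (E p \<union> E n) \<le> (1 / 2) ^ p + (1 / 2) ^ n"
      using measure_Un_le[OF E E, of p n] E_small[of p] E_small[of n] by linarith
    also have "\<dots> \<le> 1 + 1" by (intro add_mono power_le_one) auto
    also have "\<dots> < measure circle_borel (sphere 0 1)"
      using pi_gt3 by (simp add: measure_space_circle_borel)
    finally have "\<not> sphere 0 1 \<subseteq> E p \<union> E n"
      using circle.finite_measure_mono[of "sphere 0 1" "E p \<union> E n"] E by force
    then obtain \<zeta> where "\<zeta> \<in> sphere 0 1" "\<zeta> \<notin> E p" "\<zeta> \<notin> E n" by blast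
    moreover have "z \<in> stolz_angle \<zeta> (real n)"
      using cball_subset_stolz_angle[of \<zeta> r "real n"] \<open>\<zeta> \<in> sphere 0 1\<close> that by auto
    ultimately show ?thesis using f_small[of \<zeta> p z] p by simp
  qed
  have "\<exists>d h. 0 < d \<and> summable h \<and> range h \<subseteq> \<real>\<^sub>\<ge>\<^sub>0 \<and>
      (\<forall>\<^sub>F n in sequentially. \<forall>y\<in>ball x d \<inter> ball 0 1. norm (f n y) \<le> norm (h n :: complex))"
    if "x \<in> ball 0 1" for x
  proof (intro exI conjI)
    let ?d = "(1 - norm x) / 2"
    let ?r = "(1 + norm x) / 2"
    show "0 < ?d" using that by simp
    show "summable (\<lambda>n. complex_of_real ((1 / 2) ^ n))"
      by (subst summable_of_real_iff) (simp add: summable_geometric)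
    show "range (\<lambda>n. complex_of_real ((1 / 2) ^ n)) \<subseteq> \<real>\<^sub>\<ge>\<^sub>0" by auto
    obtain n0 where n0: "2 / (1 - ?r) \<le> real n0" using real_arch_simple by blast
    have r: "?r < 1" using that by simp
    have "norm (f n y) \<le> norm (complex_of_real ((1 / 2) ^ n))"
      if "n \<ge> Suc n0" "y \<in> ball x ?d \<inter> ball 0 1" for n y
    proof -
      have "dist x y < ?d" using that by simp
      then have "norm y \<le> norm x + ?d"
        using norm_triangle_ineq2[of y x] unfolding dist_norm norm_minus_commute[of x y] by linarith
      also have "\<dots> = ?r" by (simp add: field_simps)
      finally have "norm y \<le> ?r" .
      moreover have "2 / (1 - ?r) \<le> real n" using n0 that(1) by simp
      then have "2 \<le> real n * (1 - ?r)" using r by (simp only: pos_divide_le_eq diff_gt_0_iff_gt)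
      ultimately have "norm (f n y) \<le> (1 / 2) ^ n"
        using that(1) r by (intro f_small_inside[of n ?r y]) auto
      then show ?thesis by (simp add: norm_power norm_divide)
    qed
    then show "\<forall>\<^sub>F n in sequentially. \<forall>y\<in>ball x ?d \<inter> ball 0 1.
        norm (f n y) \<le> norm (complex_of_real ((1 / 2) ^ n))"
      unfolding eventually_sequentially by blast
  qed
  then obtain F where F: "\<forall>z\<in>ball 0 1. (\<lambda>n. f n z) sums F z \<and> F field_differentiable (at z)"
    by (rule series_differentiable_comparison_complex[OF open_ball, of 0 1 f, rotated])
       (use hol in \<open>auto simp: holomorphic_on_open field_differentiable_def\<close>)
  have "F holomorphic_on ball 0 1"
    using F by (auto simp: holomorphic_on_def intro: field_differentiable_at_within)
  moreover have "AE \<zeta> in circle_borel. \<forall>M. ((\<lambda>z. Re (\<nu> \<zeta> * F z)) \<longlongrightarrow> \<phi> \<zeta>) (at \<zeta> within stolz_angle \<zeta> M)"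
  proof -
    have "summable (\<lambda>n. measure circle_borel (E n))"
      by (rule summable_comparison_test'[where g = "\<lambda>n. (1 / 2) ^ n" and N = 0])
         (use E_small in \<open>auto simp: summable_geometric\<close>)
    then have "AE \<zeta> in circle_borel. \<forall>\<^sub>F n in sequentially. \<zeta> \<in> space circle_borel - E n"
      by (intro borel_cantelli_AE1 E) (auto simp: circle.emeasure_finite less_top[symmetric])
    moreover have "AE \<zeta> in circle_borel. \<forall>n. isCont (f n) \<zeta>"
      using cont by (simp add: AE_all_countable)
    ultimately show ?thesis
    proof eventually_elim
      case (elim \<zeta>)
      then obtain n0 where n0: "\<And>n. n \<ge> n0 \<Longrightarrow> \<zeta> \<in> sphere 0 1 - E n"
        by (auto simp: eventually_sequentially)
      show ?case
      proof (intro allI tendstoI)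
        fix M e :: real assume "e > 0"
        obtain a where a: "(1 / 2) ^ a < e / 3"
          using real_arch_pow_inv[of "e / 3" "1 / 2"] \<open>e > 0\<close> by auto
        obtain b where b: "M \<le> real b" using real_arch_simple by blast
        define p where "p = n0 + a + b"
        have "(1 / 2) ^ p \<le> ((1 / 2) ^ a :: real)" by (intro power_decreasing) (auto simp: p_def)
        then have p: "(1 / 2) ^ p < e / 3" using a by linarith
        have "norm (\<nu> \<zeta>) = 1" using n0[of n0] norm_\<nu> by auto
        have tail: "norm (F z - S (Suc p) z) \<le> (1 / 2) ^ p" if z: "z \<in> stolz_angle \<zeta> M" for z
        proof -
          have "z \<in> ball 0 1" using z by (simp add: stolz_angle_iff)
          then have "(\<lambda>i. f (i + Suc p) z) sums (F z - S (Suc p) z)"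
            unfolding S_def using F sums_split_initial_segment by blast
          then have "F z - S (Suc p) z = (\<Sum>i. f (i + Suc p) z)" by (rule sums_unique)
          also have "norm \<dots> \<le> (\<Sum>i. (1 / 2) ^ p * (1 / 2) * (1 / 2) ^ i)"
          proof (rule norm_suminf_le)
            fix i
            have "stolz_angle \<zeta> M \<subseteq> stolz_angle \<zeta> (real (Suc (i + p)))"
              by (rule stolz_angle_mono) (use b in \<open>simp add: p_def\<close>)
            then have "norm (f (Suc (i + p)) z) \<le> (1 / 2) ^ Suc (i + p)"
              using z n0[of "i + p"] n0[of "Suc (i + p)"] by (intro f_small[of \<zeta>]) (auto simp: p_def)
            then show "norm (f (i + Suc p) z) \<le> (1 / 2) ^ p * (1 / 2) * (1 / 2) ^ i"
              by (simp add: power_add mult_ac)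
          qed (intro summable_mult summable_geometric, simp)
          also have "\<dots> = (1 / 2) ^ p"
            by (subst suminf_mult) (simp_all add: suminf_geometric summable_geometric)
          finally show ?thesis .
        qed
        have "isCont (S (Suc p)) \<zeta>"
          unfolding S_def using elim(2) by (intro continuous_intros) auto
        then have "((\<lambda>z. S (Suc p) z) \<longlongrightarrow> S (Suc p) \<zeta>) (at \<zeta> within stolz_angle \<zeta> M)"
          unfolding isCont_def by (rule tendsto_within_subset) simp
        then have near: "\<forall>\<^sub>F z in at \<zeta> within stolz_angle \<zeta> M. dist (S (Suc p) z) (S (Suc p) \<zeta>) < e / 3"
          by (rule tendstoD) (use \<open>e > 0\<close> in simp)
        have inside: "\<forall>\<^sub>F z in at \<zeta> within stolz_angle \<zeta> M. z \<in> stolz_angle \<zeta> M"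
          by (simp add: eventually_at_filter)
        show "\<forall>\<^sub>F z in at \<zeta> within stolz_angle \<zeta> M. dist (Re (\<nu> \<zeta> * F z)) (\<phi> \<zeta>) < e"
          using near inside
        proof eventually_elim
          case (elim z)
          \<comment> \<open>Tail of the series, continuity of the partial sum at \<open>\<zeta>\<close>, and residual.\<close>
          have "Re (\<nu> \<zeta> * F z) - \<phi> \<zeta> = Re (\<nu> \<zeta> * (F z - S (Suc p) z))
              + Re (\<nu> \<zeta> * (S (Suc p) z - S (Suc p) \<zeta>)) - \<psi> (S (Suc p)) \<zeta>"
            by (simp add: \<psi>_def algebra_simps)
          moreover have "\<bar>Re (\<nu> \<zeta> * w)\<bar> \<le> norm w" for w
            using abs_Re_le_cmod[of "\<nu> \<zeta> * w"] \<open>norm (\<nu> \<zeta>) = 1\<close> by (simp add: norm_mult)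
          note this[of "F z - S (Suc p) z"] this[of "S (Suc p) z - S (Suc p) \<zeta>"]
          moreover have "\<bar>\<psi> (S (Suc p)) \<zeta>\<bar> \<le> (1 / 2) ^ p"
            using residual[of \<zeta> p] n0[of p] by (simp add: t_def p_def)
          ultimately show ?case
            using tail[OF elim(2)] elim(1) p unfolding dist_norm real_norm_def by linarith
        qed
      qed
    qed
  qed
  ultimately show ?thesis by blast
qed

section \<open>The oblique derivative problem\<close>

lemma ex_borel_measurable_complex:
  fixes g :: "'a \<Rightarrow> complex"
  assumes g: "g \<in> borel_measurable (completion M)"
  shows "\<exists>g'\<in>borel_measurable M. AE x in M. g x = g' x"
proof -
  have "(\<lambda>x. Re (g x)) \<in> borel_measurable (completion M)" "(\<lambda>x. Im (g x)) \<in> borel_measurable (completion M)"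
    using g by measurable
  from this[THEN completion_ex_borel_measurable_real] obtain a b where
    [measurable]: "a \<in> borel_measurable M" "b \<in> borel_measurable M"
    and ae: "AE x in M. Re (g x) = a x" "AE x in M. Im (g x) = b x" by blast
  have "(\<lambda>x. Complex (a x) (b x)) \<in> borel_measurable M"
    by (simp add: Complex_eq)
  moreover have "AE x in M. g x = Complex (a x) (b x)"
    using ae by eventually_elim (simp add: complex_eq_iff)
  ultimately show ?thesis
    by (intro bexI[of _ "\<lambda>x. Complex (a x) (b x)"])
qed

theorem theorem1:
  fixes \<nu> :: "complex \<Rightarrow> complex" and \<phi> :: "complex \<Rightarrow> real"
  assumes "\<nu> \<in> borel_measurable arc_length"
    and "\<And>\<zeta>. \<zeta> \<in> sphere 0 1 \<Longrightarrow> norm (\<nu> \<zeta>) = 1"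
    and "\<phi> \<in> borel_measurable arc_length"
  shows "\<exists>u. harmonic_on (ball 0 1) u \<and>
    (AE \<zeta> in arc_length. \<forall>\<gamma>. nontangential_path \<zeta> \<gamma> \<longrightarrow>
       ((\<lambda>t. dir_deriv u (\<nu> \<zeta>) (\<gamma> t)) \<longlongrightarrow> \<phi> \<zeta>) (at_left 1))"
proof -
  obtain \<nu>' where \<nu>' [measurable]: "\<nu>' \<in> borel_measurable circle_borel"
    and \<nu>_eq: "AE \<zeta> in circle_borel. \<nu> \<zeta> = \<nu>' \<zeta>"
    using ex_borel_measurable_complex assms(1) unfolding arc_length_eq_completion by blast
  obtain \<phi>' where \<phi>': "\<phi>' \<in> borel_measurable circle_borel"
    and \<phi>_eq: "AE \<zeta> in circle_borel. \<phi> \<zeta> = \<phi>' \<zeta>"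
    using completion_ex_borel_measurable_real assms(3) unfolding arc_length_eq_completion by blast
  \<comment> \<open>A Borel version of \<open>\<nu>\<close> has modulus \<open>1\<close> only almost everywhere.\<close>
  define \<mu> where "\<mu> \<zeta> = (if norm (\<nu>' \<zeta>) = 1 then \<nu>' \<zeta> else 1)" for \<zeta>
  have "{\<zeta> \<in> space circle_borel. norm (\<nu>' \<zeta>) = 1} \<in> sets circle_borel" by measurable
  then have "\<mu> \<in> borel_measurable circle_borel"
    unfolding \<mu>_def[abs_def] by (intro measurable_If \<nu>' measurable_const) auto
  moreover have "norm (\<mu> \<zeta>) = 1" for \<zeta>
    by (simp add: \<mu>_def)
  ultimately obtain F where F: "F holomorphic_on ball 0 1" and
    lim: "AE \<zeta> in circle_borel. \<forall>M. ((\<lambda>z. Re (\<mu> \<zeta> * F z)) \<longlongrightarrow> \<phi>' \<zeta>) (at \<zeta> within stolz_angle \<zeta> M)"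
    using ex_holomorphic_with_Re_limit[OF _ _ \<phi>', of \<mu>] by blast
  obtain \<Phi> where \<Phi>: "\<And>z. z \<in> ball 0 1 \<Longrightarrow> (\<Phi> has_field_derivative F z) (at z)"
    using holomorphic_convex_primitive'[OF convex_ball open_ball F]
    by (metis at_within_open open_ball)
  define u where "u z = Re (\<Phi> z)" for z
  have u: "harmonic_on (ball 0 1) u"
    and du: "\<And>z v. z \<in> ball 0 1 \<Longrightarrow> dir_deriv u v z = Re (v * F z)"
    unfolding u_def using harmonic_on_Re_primitive[OF open_ball F \<Phi>] by auto
  have "AE \<zeta> in circle_borel. \<forall>\<gamma>. nontangential_path \<zeta> \<gamma> \<longrightarrow>
       ((\<lambda>t. dir_deriv u (\<nu> \<zeta>) (\<gamma> t)) \<longlongrightarrow> \<phi> \<zeta>) (at_left 1)"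
    using lim \<nu>_eq \<phi>_eq AE_space
  proof eventually_elim
    case (elim \<zeta>)
    then have \<mu>: "\<mu> \<zeta> = \<nu> \<zeta>" using assms(2)[of \<zeta>] by (simp add: \<mu>_def)
    show ?case
    proof (intro allI impI)
      fix \<gamma> assume \<gamma>: "nontangential_path \<zeta> \<gamma>"
      then obtain M where M: "\<forall>\<^sub>F t in at_left 1. \<gamma> t \<in> stolz_angle \<zeta> M"
        unfolding nontangential_path_def by blast
      have "continuous_on {0..1} \<gamma>" and "\<gamma> 1 = \<zeta>"
        using \<gamma> by (auto simp: nontangential_path_def path_def pathfinish_def)
      then have "(\<gamma> \<longlongrightarrow> \<zeta>) (at 1 within {0..1})"
        by (auto simp: continuous_on_def)
      then have "(\<gamma> \<longlongrightarrow> \<zeta>) (at_left 1)"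
        by (simp add: at_within_Icc_at_left)
      moreover have "\<forall>\<^sub>F t in at_left 1. \<gamma> t \<in> stolz_angle \<zeta> M \<and> \<gamma> t \<noteq> \<zeta>"
        using M by eventually_elim (use elim(4) in \<open>auto simp: stolz_angle_iff\<close>)
      ultimately have *: "filterlim \<gamma> (at \<zeta> within stolz_angle \<zeta> M) (at_left 1)"
        by (simp add: filterlim_at)
      have "((\<lambda>t. Re (\<mu> \<zeta> * F (\<gamma> t))) \<longlongrightarrow> \<phi>' \<zeta>) (at_left 1)"
        by (rule filterlim_compose[OF elim(1)[rule_format] *])
      moreover have "\<forall>\<^sub>F t in at_left 1. Re (\<mu> \<zeta> * F (\<gamma> t)) = dir_deriv u (\<nu> \<zeta>) (\<gamma> t)"
        using M by eventually_elim (simp add: du \<mu> stolz_angle_iff)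
      ultimately show "((\<lambda>t. dir_deriv u (\<nu> \<zeta>) (\<gamma> t)) \<longlongrightarrow> \<phi> \<zeta>) (at_left 1)"
        using elim(3) by (simp add: tendsto_cong)
    qed
  qed
  then show ?thesis
    using u unfolding arc_length_eq_completion by (blast intro: AE_completion)
qed

end
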